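(* Let $X$ be a compact metric space and $\varepsilon>0$. Suppose that there is some $\sigma$ with $0<\sigma\le\varepsilon$ such that if $d(x,y)<\sigma$ in $X$ and $(x,y)$ is a sink then there are arbitrarily fine chains $\beta$ from $x$ to $y$ such that $[\beta]_{\varepsilon}=[x,y]_{\varepsilon}$. Then whenever $d(x,y)<\sigma$ in $X$ there exist arbitrarily fine chains $\alpha$ from $x$ to $y$ such that $[\alpha]_{\varepsilon}=[x,y]_{\varepsilon}$. In particular, compact locally sink-free metric spaces are weakly chained.
   Context: In a metric space, an $\varepsilon$-chain is a finite sequence $\{x_0,\dots,x_n\}$ with $d(x_i,x_{i+1})<\varepsilon$ for all $i$. An $\varepsilon$-homotopy between $\varepsilon$-chains with the same endpoints is a finite sequence of $\varepsilon$-chains with the same endpoints, each differing from the next by adding or removing a single point (never an endpoint); $[\alpha]_\varepsilon$ is the $\varepsilon$-homotopy class and $[x,y]_\varepsilon$ the class of $\{x,y\}$. "Arbitrarily fine chains with a property" means that for every $\tau>0$ there is a $\tau$-chain with the property (it is also an $\varepsilon$-chain). $X$ is chain connected if every two points are joined by a $\tau$-chain for every $\tau>0$. $X$ is weakly chained if it is chain connected and for every $\varepsilon>0$ there is $\delta>0$ such that whenever $d(x,y)<\delta$ there are arbitrarily fine chains $\alpha$ from $x$ to $y$ with $[\alpha]_\varepsilon=[x,y]_\varepsilon$. A sink is a pair $(x,y)\in X\times X$, $x\ne y$, at which the distance function on $X\times X$ has a (possibly not strict) local minimum. $X$ is locally sink-free if it is chain connected and there is $\sigma>0$ such that every sink $(x,y)$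 satisfies $d(x,y)\geq\sigma$. *)

theory Defs
  imports "HOL-Analysis.Analysis"
begin

context Metric_space
begin

text \<open>A finite sequence of points is a nonempty list; the one-point list is a chain from
  a point to itself.\<close>

definition eps_chain :: "real \<Rightarrow> 'a \<Rightarrow> 'a \<Rightarrow> 'a list \<Rightarrow> bool" where
  "eps_chain \<epsilon> x y \<alpha> \<longleftrightarrow>
     \<alpha> \<noteq> [] \<and> set \<alpha> \<subseteq> M \<and> hd \<alpha> = x \<and> last \<alpha> = y \<and> successively (\<lambda>u v. d u v < \<epsilon>) \<alpha>"

text \<open>Both parts of the split are nonempty, so the inserted point is never an endpoint.\<close>

definition adds_point :: "'a list \<Rightarrow> 'a list \<Rightarrow> bool" where
  "adds_point \<alpha> \<beta> \<longleftrightarrow> (\<exists>us z ws. us \<noteq> [] \<and> ws \<noteq> [] \<and> \<alpha> = us @ ws \<and> \<beta> = us @ [z] @ ws)"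

definition eps_homotopy :: "real \<Rightarrow> 'a \<Rightarrow> 'a \<Rightarrow> 'a list list \<Rightarrow> bool" where
  "eps_homotopy \<epsilon> x y H \<longleftrightarrow>
     H \<noteq> [] \<and> (\<forall>\<gamma>\<in>set H. eps_chain \<epsilon> x y \<gamma>) \<and>
     successively (\<lambda>\<gamma> \<gamma>'. adds_point \<gamma> \<gamma>' \<or> adds_point \<gamma>' \<gamma>) H"

definition eps_homotopic :: "real \<Rightarrow> 'a list \<Rightarrow> 'a list \<Rightarrow> bool" where
  "eps_homotopic \<epsilon> \<alpha> \<beta> \<longleftrightarrow> (\<exists>x y H. eps_homotopy \<epsilon> x y H \<and> hd H = \<alpha> \<and> last H = \<beta>)"

definition eps_class :: "real \<Rightarrow> 'a list \<Rightarrow> 'a list set" where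
  "eps_class \<epsilon> \<alpha> = {\<beta>. eps_homotopic \<epsilon> \<alpha> \<beta>}"

text \<open>The class of \<open>\<alpha>\<close> only makes sense if \<open>\<alpha>\<close> is an \<open>\<epsilon>\<close>-chain (\<open>eps_class\<close> is empty
  otherwise), which is automatic for \<open>\<tau> \<le> \<epsilon>\<close> and is therefore required explicitly
  for the larger \<open>\<tau>\<close>. If \<open>d x y \<ge> \<epsilon>\<close>, the condition is false.\<close>

definition fine_chains_homotopic_to_pair :: "real \<Rightarrow> 'a \<Rightarrow> 'a \<Rightarrow> bool" where
  "fine_chains_homotopic_to_pair \<epsilon> x y \<longleftrightarrow>
     (\<forall>\<tau>>0. \<exists>\<alpha>. eps_chain \<tau> x y \<alpha> \<and> eps_chain \<epsilon> x y \<alpha> \<and> eps_class \<epsilon> \<alpha> = eps_class \<epsilon> [x, y])"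

definition chain_connected :: bool where
  "chain_connected \<longleftrightarrow> (\<forall>x\<in>M. \<forall>y\<in>M. \<forall>\<tau>>0. \<exists>\<alpha>. eps_chain \<tau> x y \<alpha>)"

definition weakly_chained :: bool where
  "weakly_chained \<longleftrightarrow>
     chain_connected \<and>
     (\<forall>\<epsilon>>0. \<exists>\<delta>>0. \<forall>x\<in>M. \<forall>y\<in>M. d x y < \<delta> \<longrightarrow> fine_chains_homotopic_to_pair \<epsilon> x y)"

definition sink :: "'a \<Rightarrow> 'a \<Rightarrow> bool" where
  "sink x y \<longleftrightarrow>
     x \<in> M \<and> y \<in> M \<and> x \<noteq> y \<and>
     (\<exists>U. openin (prod_topology mtopology mtopology) U \<and> (x, y) \<in> U \<and>
          (\<forall>(x', y')\<in>U. d x y \<le> d x' y'))"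

definition locally_sink_free :: bool where
  "locally_sink_free \<longleftrightarrow> chain_connected \<and> (\<exists>\<sigma>>0. \<forall>x y. sink x y \<longrightarrow> \<sigma> \<le> d x y)"

end

end

theory Submission
  imports Defs
begin

text \<open>
  The idea is a distance-minimising argument, carried out separately for each fineness \<open>\<tau>\<close>. Call
  a pair \<open>(x, y)\<close> refinable if \<open>[x, y]\<close> is \<open>\<epsilon>\<close>-homotopic to some \<open>\<tau>\<close>-chain. A small displacement
  of both points preserves refinability, because one can go from \<open>x\<close> to the displaced point \<open>x'\<close>,
  follow a \<open>\<tau>\<close>-chain to \<open>y'\<close> and come back to \<open>y\<close> (\<open>refinable_displace\<close>). Thus, among the pairs
  at distance less than \<open>\<sigma>\<close>, both the refinable and the non-refinable ones form open subsets of the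
  square (\<open>openin_refinable\<close>).

  If some pair at distance \<open>s < \<sigma>\<close> is not refinable, then the non-refinable pairs at distance at
  most \<open>s\<close> form a nonempty compact set, on which the distance attains a minimum. The minimiser
  is off the diagonal, since diagonal pairs are refinable. Its neighbours are also
  non-refinable, so none of them is closer together: the minimiser is a sink
  (\<open>ex_nonrefinable_sink\<close>). This contradicts the assumption on sinks at distance below \<open>\<sigma>\<close>. In a
  locally sink-free space that assumption is vacuous for small \<open>\<sigma>\<close>.
\<close>

context Metric_space
begin

section \<open>Homotopy of chains\<close>

lemma eps_homotopic_chains:
  assumes "eps_homotopic \<epsilon> \<alpha> \<beta>"
  obtains x y where "eps_chain \<epsilon> x y \<alpha>" "eps_chain \<epsilon> x y \<beta>"
  using assms unfolding eps_homotopic_def eps_homotopy_def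
  by (metis hd_in_set last_in_set)

lemma eps_homotopic_refl: "eps_chain \<epsilon> x y \<alpha> \<Longrightarrow> eps_homotopic \<epsilon> \<alpha> \<alpha>"
  unfolding eps_homotopic_def eps_homotopy_def
  by (intro exI[of _ x] exI[of _ y] exI[of _ "[\<alpha>]"]) simp

lemma eps_homotopic_sym:
  assumes "eps_homotopic \<epsilon> \<alpha> \<beta>"
  shows "eps_homotopic \<epsilon> \<beta> \<alpha>"
proof -
  obtain x y H where H: "eps_homotopy \<epsilon> x y H" "hd H = \<alpha>" "last H = \<beta>"
    using assms unfolding eps_homotopic_def by blast
  have "eps_homotopy \<epsilon> x y (rev H)"
    using H(1) by (simp add: eps_homotopy_def disj_commute)
  moreover have "hd (rev H) = \<beta>" "last (rev H) = \<alpha>"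
    using H by (simp_all add: hd_rev last_rev)
  ultimately show ?thesis
    unfolding eps_homotopic_def by blast
qed

lemma eps_homotopic_trans:
  assumes "eps_homotopic \<epsilon> \<alpha> \<beta>" "eps_homotopic \<epsilon> \<beta> \<gamma>"
  shows "eps_homotopic \<epsilon> \<alpha> \<gamma>"
proof -
  obtain x y H where H: "eps_homotopy \<epsilon> x y H" "hd H = \<alpha>" "last H = \<beta>"
    using assms unfolding eps_homotopic_def by blast
  obtain x' y' K where K: "eps_homotopy \<epsilon> x' y' K" "hd K = \<beta>" "last K = \<gamma>"
    using assms unfolding eps_homotopic_def by blast
  obtain L where L: "K = \<beta> # L"
    using K by (metis eps_homotopy_def list.collapse)
  have \<beta>: "eps_chain \<epsilon> x y \<beta>" "eps_chain \<epsilon> x' y' \<beta>"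
    using H K unfolding eps_homotopy_def by (metis last_in_set hd_in_set)+
  then have [simp]: "x' = x" "y' = y"
    by (auto simp: eps_chain_def)
  have "eps_homotopy \<epsilon> x y (H @ L)"
    using H K L by (auto simp: eps_homotopy_def successively_append_iff successively_Cons)
  moreover have "hd (H @ L) = \<alpha>" "last (H @ L) = \<gamma>"
    using H K L by (auto simp: eps_homotopy_def)
  ultimately show ?thesis
    unfolding eps_homotopic_def by blast
qed

lemma eps_homotopic_adds_point:
  assumes "eps_chain \<epsilon> x y \<alpha>" "eps_chain \<epsilon> x y \<beta>" "adds_point \<alpha> \<beta>"
  shows "eps_homotopic \<epsilon> \<alpha> \<beta>"
  unfolding eps_homotopic_def eps_homotopy_def
  by (intro exI[of _ x] exI[of _ y] exI[of _ "[\<alpha>, \<beta>]"]) (use assms in simp)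

lemma eps_class_eq_iff:
  assumes "eps_chain \<epsilon> x y \<beta>"
  shows "eps_class \<epsilon> \<alpha> = eps_class \<epsilon> \<beta> \<longleftrightarrow> eps_homotopic \<epsilon> \<alpha> \<beta>"
proof
  assume "eps_class \<epsilon> \<alpha> = eps_class \<epsilon> \<beta>"
  then show "eps_homotopic \<epsilon> \<alpha> \<beta>"
    using eps_homotopic_refl[OF assms] by (auto simp: eps_class_def)
next
  assume "eps_homotopic \<epsilon> \<alpha> \<beta>"
  then show "eps_class \<epsilon> \<alpha> = eps_class \<epsilon> \<beta>"
    unfolding eps_class_def by (auto intro: eps_homotopic_trans eps_homotopic_sym)
qed

lemma eps_chain_extend:
  assumes "eps_chain \<epsilon> x' y' \<alpha>" "x \<in> M" "y \<in> M" "d x x' < \<epsilon>" "d y' y < \<epsilon>"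
  shows "eps_chain \<epsilon> x y (x # \<alpha> @ [y])"
  using assms by (auto simp: eps_chain_def successively_append_iff successively_Cons)

lemma adds_point_extend:
  assumes "adds_point \<alpha> \<beta>"
  shows "adds_point (x # \<alpha> @ [y]) (x # \<beta> @ [y])"
proof -
  obtain us z ws where "us \<noteq> []" "ws \<noteq> []" "\<alpha> = us @ ws" "\<beta> = us @ [z] @ ws"
    using assms unfolding adds_point_def by blast
  then show ?thesis
    unfolding adds_point_def
    by (intro exI[of _ "x # us"] exI[of _ z] exI[of _ "ws @ [y]"]) simp
qed

lemma eps_homotopic_extend:
  assumes "eps_homotopic \<epsilon> \<alpha> \<beta>" "eps_chain \<epsilon> x' y' \<alpha>"
    and "x \<in> M" "y \<in> M" "d x x' < \<epsilon>" "d y' y < \<epsilon>"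
  shows "eps_homotopic \<epsilon> (x # \<alpha> @ [y]) (x # \<beta> @ [y])"
proof -
  let ?e = "\<lambda>\<gamma>. x # \<gamma> @ [y]"
  obtain u v H where H: "eps_homotopy \<epsilon> u v H" "hd H = \<alpha>" "last H = \<beta>"
    using assms unfolding eps_homotopic_def by blast
  have "eps_chain \<epsilon> u v \<alpha>"
    using H unfolding eps_homotopy_def by (metis hd_in_set)
  then have [simp]: "u = x'" "v = y'"
    using assms(2) by (auto simp: eps_chain_def)
  have "successively (\<lambda>\<gamma> \<gamma>'. adds_point (?e \<gamma>) (?e \<gamma>') \<or> adds_point (?e \<gamma>') (?e \<gamma>)) H"
    using H(1) unfolding eps_homotopy_def
    by (auto elim!: successively_mono dest: adds_point_extend)
  then have "eps_homotopy \<epsilon> x y (map ?e H)"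
    using H(1) assms(3-) by (auto simp: eps_homotopy_def successively_map intro: eps_chain_extend)
  moreover have "hd (map ?e H) = ?e \<alpha>" "last (map ?e H) = ?e \<beta>"
    using H by (auto simp: eps_homotopy_def hd_map last_map)
  ultimately show ?thesis
    unfolding eps_homotopic_def by blast
qed

section \<open>Refinable pairs\<close>

definition refinable :: "real \<Rightarrow> real \<Rightarrow> 'a \<Rightarrow> 'a \<Rightarrow> bool" where
  "refinable \<epsilon> \<tau> x y \<longleftrightarrow> (\<exists>\<alpha>. eps_chain \<tau> x y \<alpha> \<and> eps_homotopic \<epsilon> \<alpha> [x, y])"

lemma eps_chain_pair: "eps_chain \<epsilon> x y [x, y] \<longleftrightarrow> x \<in> M \<and> y \<in> M \<and> d x y < \<epsilon>"
  by (auto simp: eps_chain_def)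

lemma fine_chains_homotopic_to_pair_iff_refinable:
  assumes "x \<in> M" "y \<in> M" "d x y < \<epsilon>"
  shows "fine_chains_homotopic_to_pair \<epsilon> x y \<longleftrightarrow> (\<forall>\<tau>>0. refinable \<epsilon> \<tau> x y)"
proof -
  have pair: "eps_chain \<epsilon> x y [x, y]"
    using assms by (simp add: eps_chain_pair)
  have "eps_chain \<epsilon> x y \<alpha>" if "eps_homotopic \<epsilon> \<alpha> [x, y]" for \<alpha>
    using that pair by (elim eps_homotopic_chains) (auto simp: eps_chain_def)
  then show ?thesis
    unfolding fine_chains_homotopic_to_pair_def refinable_def eps_class_eq_iff[OF pair] by blast
qed

lemma refinable_diagonal:
  assumes "x \<in> M" "0 < \<epsilon>" "0 < \<tau>"
  shows "refinable \<epsilon> \<tau> x x"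
  using assms eps_homotopic_refl[of \<epsilon> x x "[x, x]"] unfolding refinable_def
  by (intro exI[of _ "[x, x]"]) (simp add: eps_chain_pair)

text \<open>
  The pair \<open>[x, y]\<close> is homotopic to \<open>[x, x', y', y]\<close> through \<open>[x, x', y]\<close>, which is why the diagonal
  distance \<open>d x' y\<close> has to be less than \<open>\<epsilon>\<close> as well. The middle step \<open>[x', y']\<close> can then be replaced by
  a \<open>\<tau>\<close>-chain, and the steps at both ends are themselves short.
\<close>
lemma refinable_displace:
  assumes "refinable \<epsilon> \<tau> x' y'"
    and M: "x \<in> M" "y \<in> M" "x' \<in> M" "y' \<in> M"
    and \<tau>: "d x x' < \<tau>" "d y' y < \<tau>"
    and \<epsilon>: "d x x' < \<epsilon>" "d y' y < \<epsilon>" "d x y < \<epsilon>" "d x' y < \<epsilon>" "d x' y' < \<epsilon>"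
  shows "refinable \<epsilon> \<tau> x y"
proof -
  obtain \<alpha> where \<alpha>: "eps_chain \<tau> x' y' \<alpha>" "eps_homotopic \<epsilon> \<alpha> [x', y']"
    using assms(1) unfolding refinable_def by blast
  have "adds_point [x, y] [x, x', y]"
    unfolding adds_point_def by (intro exI[of _ "[x]"] exI[of _ x'] exI[of _ "[y]"]) simp
  then have 1: "eps_homotopic \<epsilon> [x, y] [x, x', y]"
    by (rule eps_homotopic_adds_point[rotated 2, where x = x and y = y])
      (use M \<epsilon> in \<open>simp_all add: eps_chain_def\<close>)
  have "adds_point [x, x', y] [x, x', y', y]"
    unfolding adds_point_def by (intro exI[of _ "[x, x']"] exI[of _ y'] exI[of _ "[y]"]) simp
  then have 2: "eps_homotopic \<epsilon> [x, x', y] [x, x', y', y]"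
    by (rule eps_homotopic_adds_point[rotated 2, where x = x and y = y])
      (use M \<epsilon> in \<open>simp_all add: eps_chain_def\<close>)
  have "eps_homotopic \<epsilon> (x # [x', y'] @ [y]) (x # \<alpha> @ [y])"
    using M \<epsilon> \<alpha>(2) by (intro eps_homotopic_extend[of _ _ _ x' y'] eps_homotopic_sym[OF \<alpha>(2)])
      (simp_all add: eps_chain_pair)
  then have "eps_homotopic \<epsilon> [x, y] (x # \<alpha> @ [y])"
    using eps_homotopic_trans[OF 1 eps_homotopic_trans[OF 2]] by simp
  moreover have "eps_chain \<tau> x y (x # \<alpha> @ [y])"
    using \<alpha>(1) M \<tau> by (intro eps_chain_extend)
  ultimately show ?thesis
    unfolding refinable_def using eps_homotopic_sym by blast
qed

text \<open>
  Refinability is locally constant among the pairs at distance less than \<open>\<sigma>\<close>; the truth value \<open>b\<close>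
  treats the refinable and the non-refinable pairs at once.
\<close>
lemma openin_refinable:
  assumes "0 < \<tau>" "\<sigma> \<le> \<epsilon>"
  shows "openin (prod_topology mtopology mtopology)
           {(x, y). x \<in> M \<and> y \<in> M \<and> d x y < \<sigma> \<and> refinable \<epsilon> \<tau> x y = b}"
    (is "openin _ ?W")
  unfolding openin_prod_topology_alt
proof (intro allI impI)
  fix x y assume "(x, y) \<in> ?W"
  then have xy: "x \<in> M" "y \<in> M" "d x y < \<sigma>" "refinable \<epsilon> \<tau> x y = b"
    by auto
  \<comment> \<open>Half of the slack, so that displacing both points keeps the distance below \<open>\<sigma>\<close>;
     this also gives \<open>r < \<sigma> \<le> \<epsilon>\<close>.\<close>
  define r where "r = min \<tau> ((\<sigma> - d x y) / 2)"
  have "r \<le> (\<sigma> - d x y) / 2"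
    unfolding r_def by (rule min.cobounded2)
  then have r: "0 < r" "r \<le> \<tau>" "2 * r \<le> \<sigma> - d x y"
    using assms xy by (auto simp: r_def)
  have "(x', y') \<in> ?W" if "x' \<in> mball x r" "y' \<in> mball y r" for x' y'
  proof -
    have M': "x' \<in> M" "y' \<in> M" and near: "d x x' < r" "d y y' < r"
      using that by auto
    have sym: "d x' x = d x x'" "d y' y = d y y'"
      by (simp_all add: commute)
    have "0 \<le> d x y" "d x' y \<le> d x' x + d x y" "d x y' \<le> d x y + d y y'"
      "d x' y' \<le> d x' y + d y y'"
      using xy M' by (simp_all add: triangle)
    then have bounds: "r < \<epsilon>" "d x' y < \<epsilon>" "d x y' < \<epsilon>" "d x y < \<epsilon>" "d x' y' < \<sigma>" "d x' y' < \<epsilon>"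
      using near r xy assms(2) sym by linarith+
    have "refinable \<epsilon> \<tau> x' y' = refinable \<epsilon> \<tau> x y"
      using refinable_displace[of \<epsilon> \<tau> x y x' y'] refinable_displace[of \<epsilon> \<tau> x' y' x y]
        xy M' near r bounds sym by force
    then show ?thesis
      using xy M' bounds by auto
  qed
  then have "mball x r \<times> mball y r \<subseteq> ?W"
    by blast
  moreover have "x \<in> mball x r" "y \<in> mball y r"
    using xy r by auto
  ultimately show "\<exists>U V. openin mtopology U \<and> openin mtopology V \<and> x \<in> U \<and> y \<in> V \<and> U \<times> V \<subseteq> ?W"
    using openin_mball by blast
qed

section \<open>Minimising the distance over the non-refinable pairs\<close>

lemma continuous_map_dist:
  "continuous_map (prod_topology mtopology mtopology) euclideanreal (\<lambda>(x, y). d x y)"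
  using continuous_map_mdist_alt[of "prod_topology mtopology mtopology" Self "\<lambda>p. p"]
  by (simp add: mtopology_of_def)

text \<open>
  The bound \<open>s\<close> on the distance turns the open condition \<open>d x y < \<sigma>\<close> into a closed one, so that
  compactness gives a minimiser; non-refinability, being locally constant, then passes to its neighbours.
\<close>
lemma ex_nonrefinable_sink:
  assumes "compact_space mtopology" "0 < \<tau>" "\<sigma> \<le> \<epsilon>"
    and a: "a \<in> M" "b \<in> M" "d a b < \<sigma>" "\<not> refinable \<epsilon> \<tau> a b"
  obtains x y where "sink x y" "d x y < \<sigma>" "\<not> refinable \<epsilon> \<tau> x y"
proof -
  let ?X = "prod_topology mtopology mtopology"
  let ?dist = "\<lambda>(x, y). d x y"
  let ?W = "\<lambda>b. {(x, y). x \<in> M \<and> y \<in> M \<and> d x y < \<sigma> \<and> refinable \<epsilon> \<tau> x y = b}"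
  define C where "C = {p \<in> topspace ?X. ?dist p \<in> {..d a b}} - ?W True"
  have C_iff: "(x, y) \<in> C \<longleftrightarrow> x \<in> M \<and> y \<in> M \<and> d x y \<le> d a b \<and> \<not> refinable \<epsilon> \<tau> x y" for x y
    using a by (auto simp: C_def)
  have "closedin ?X C"
    unfolding C_def using openin_refinable[OF assms(2,3), of True]
    by (intro closedin_diff closedin_continuous_map_preimage[OF continuous_map_dist]) simp_all
  then have "compactin ?X C"
    using assms by (intro closedin_compact_space) (auto simp: compact_space_prod_topology)
  then have "compact (?dist ` C)"
    using image_compactin continuous_map_dist by fastforce
  moreover have "(a, b) \<in> C"
    using a C_iff by simp
  ultimately obtain m where m: "m \<in> ?dist ` C" "\<forall>t \<in> ?dist ` C. m \<le> t"
    using compact_attains_inf[of "?dist ` C"] by blast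
  then obtain x y where xy: "(x, y) \<in> C" "m = d x y"
    by auto
  have min: "d x y \<le> d u v" if "(u, v) \<in> C" for u v
    using m(2) xy(2) that by force
  have xyM: "x \<in> M" "y \<in> M" "d x y \<le> d a b" "\<not> refinable \<epsilon> \<tau> x y"
    using xy C_iff by auto
  have "0 < \<epsilon>"
    using a assms nonneg[of a b] by linarith
  then have "x \<noteq> y"
    using refinable_diagonal xyM assms by blast
  moreover have "d x y \<le> d u v" if "(u, v) \<in> ?W False" for u v
    \<comment> \<open>A neighbour outside \<open>C\<close> has distance greater than \<open>d a b\<close>.\<close>
    using that min[of u v] C_iff[of u v] xyM(3) by (cases "d u v \<le> d a b") auto
  moreover have "openin ?X (?W False)"
    using openin_refinable assms by blast
  moreover have "(x, y) \<in> ?W False"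
    using xyM a by auto
  ultimately have "sink x y"
    unfolding sink_def using xyM by blast
  then show thesis
    using that xyM a by auto
qed

theorem fine_chains_homotopic_to_pair_if_sinks:
  assumes "compact_space mtopology" "\<sigma> \<le> \<epsilon>"
    and sinks: "\<And>x y. sink x y \<Longrightarrow> d x y < \<sigma> \<Longrightarrow> fine_chains_homotopic_to_pair \<epsilon> x y"
    and "a \<in> M" "b \<in> M" "d a b < \<sigma>"
  shows "fine_chains_homotopic_to_pair \<epsilon> a b"
proof (rule ccontr)
  assume "\<not> ?thesis"
  then obtain \<tau> where \<tau>: "0 < \<tau>" "\<not> refinable \<epsilon> \<tau> a b"
    using assms fine_chains_homotopic_to_pair_iff_refinable by force
  then obtain x y where xy: "sink x y" "d x y < \<sigma>" "\<not> refinable \<epsilon> \<tau> x y"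
    using ex_nonrefinable_sink assms by metis
  have "x \<in> M" "y \<in> M" "d x y < \<epsilon>"
    using xy assms by (auto simp: sink_def)
  then show False
    using fine_chains_homotopic_to_pair_iff_refinable sinks xy \<tau> by blast
qed

corollary locally_sink_free_imp_weakly_chained:
  assumes "compact_space mtopology" "locally_sink_free"
  shows "weakly_chained"
proof -
  obtain \<sigma> where \<sigma>: "0 < \<sigma>" "\<And>x y. sink x y \<Longrightarrow> \<sigma> \<le> d x y"
    using assms unfolding locally_sink_free_def by blast
  have "fine_chains_homotopic_to_pair \<epsilon> x y"
    if "x \<in> M" "y \<in> M" "d x y < min \<sigma> \<epsilon>" for \<epsilon> x y
  proof (rule fine_chains_homotopic_to_pair_if_sinks[OF assms(1) _ _ that])
    show "fine_chains_homotopic_to_pair \<epsilon> u v" if "sink u v" "d u v < min \<sigma> \<epsilon>" for u v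
      using \<sigma>(2)[OF that(1)] that(2) by simp
  qed simp
  moreover have "0 < min \<sigma> \<epsilon>" if "0 < \<epsilon>" for \<epsilon>
    using \<sigma>(1) that by simp
  ultimately show ?thesis
    using assms(2) unfolding weakly_chained_def locally_sink_free_def by blast
qed

end

theorem proposition33:
  fixes M :: "'a set" and d :: "'a \<Rightarrow> 'a \<Rightarrow> real"
  assumes "Metric_space M d"
    and "compact_space (Metric_space.mtopology M d)"
  shows "(\<forall>\<epsilon> \<sigma>. 0 < \<epsilon> \<and> 0 < \<sigma> \<and> \<sigma> \<le> \<epsilon> \<and>
            (\<forall>x\<in>M. \<forall>y\<in>M. d x y < \<sigma> \<and> Metric_space.sink M d x y \<longrightarrow>
               Metric_space.fine_chains_homotopic_to_pair M d \<epsilon> x y) \<longrightarrow>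
            (\<forall>x\<in>M. \<forall>y\<in>M. d x y < \<sigma> \<longrightarrow>
               Metric_space.fine_chains_homotopic_to_pair M d \<epsilon> x y)) \<and>
         (Metric_space.locally_sink_free M d \<longrightarrow> Metric_space.weakly_chained M d)"
proof -
  interpret Metric_space M d
    by fact
  show ?thesis
  proof (intro conjI allI impI ballI)
    fix \<epsilon> \<sigma> :: real and x y
    assume hyp: "0 < \<epsilon> \<and> 0 < \<sigma> \<and> \<sigma> \<le> \<epsilon> \<and>
        (\<forall>x\<in>M. \<forall>y\<in>M. d x y < \<sigma> \<and> sink x y \<longrightarrow> fine_chains_homotopic_to_pair \<epsilon> x y)"
      and "x \<in> M" "y \<in> M" "d x y < \<sigma>"
    moreover have "fine_chains_homotopic_to_pair \<epsilon> u v" if "sink u v" "d u v < \<sigma>" for u v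
      using hyp that by (auto simp: sink_def)
    ultimately show "fine_chains_homotopic_to_pair \<epsilon> x y"
      using fine_chains_homotopic_to_pair_if_sinks assms(2) by blast
  next
    assume "locally_sink_free"
    then show "weakly_chained"
      using locally_sink_free_imp_weakly_chained assms(2) by blast
  qed
qed

end
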